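(* Let $n,p\in\mathbb N$, $a\in\mathbb C$, $a\neq 0$, $c\in\mathbb R$, $A\in\mathbb C^{n\times n}$, and let $v(x)=a\,e^{2\mathrm i c x}I_p$. (i) Assume $\det\big((A-cI_n)^2-|a|^2I_n\big)\neq 0$. Choose $Q\in\mathbb C^{n\times n}$ with $AQ=QA$ and $Q^2=(A-cI_n)^2-|a|^2I_n$. Let $f_1,f_2\in\mathbb C^{n\times p}$, $f_3=\frac1{\bar a}(Q+A-cI_n)f_1$, $f_4=-\frac1{\bar a}(Q-A+cI_n)f_2$, and $$\Lambda_1(x)=e^{-\mathrm i c x}\big(e^{\mathrm i xQ}f_1+e^{-\mathrm i xQ}f_2\big),\qquad \Lambda_2(x)=e^{\mathrm i c x}\big(e^{\mathrm i xQ}f_3+e^{-\mathrm i xQ}f_4\big),\qquad \Pi(x)=\begin{bmatrix}\Lambda_1(x)&\Lambda_2(x)\end{bmatrix}.$$ Let $S(0)=S(0)^*\in\mathbb C^{n\times n}$ satisfy $AS(0)-S(0)A^*=\mathrm i\,\Pi(0)j\Pi(0)^*$, and put $S(x)=S(0)+\int_0^x\Pi(r)\Pi(r)^*dr$. Then, at the points $x$ where $S(x)$ is invertible, the matrix function $$\psi(x,\xi)=\Pi(x)^*S(x)^{-1}e^{-\xi A}$$ satisfies the dynamical Dirac system $$\psi_x(x,\xi)+\mathrm i j\big(\psi_\xi(x,\xi)+\widetilde V(x)\psi(x,\xi)\big)=0,$$ where $\widetilde V=\begin{bmatrix}0&\widetilde v\\ \widetilde v^*&0\end{bmatrix}$ and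 $\widetilde v(x)=v(x)-2\mathrm i\,\Lambda_1(x)^*S(x)^{-1}\Lambda_2(x)$. (ii) Assume $\det\big((A-cI_n)^2+|a|^2I_n\big)\neq 0$. Choose $Q\in\mathbb C^{n\times n}$ with $AQ=QA$ and $Q^2=(A-cI_n)^2+|a|^2I_n$. Let $f_1,f_2\in\mathbb C^{n\times p}$, $f_3=\frac{\mathrm i}{\bar a}(Q+A-cI_n)f_1$, $f_4=-\frac{\mathrm i}{\bar a}(Q-A+cI_n)f_2$, and define $\Lambda_1,\Lambda_2,\Pi$ by the same formulas as in (i) in terms of $Q,f_1,\dots,f_4$. Let $S(0)=S(0)^*\in\mathbb C^{n\times n}$ satisfy $AS(0)-S(0)A^*=\mathrm i\,\Pi(0)\Pi(0)^*$, and put $S(x)=S(0)+\int_0^x\Pi(r)j\Pi(r)^*dr$. Then, at the points $x$ where $S(x)$ is invertible, the matrix function $\psi(x,\xi)=\Pi(x)^*S(x)^{-1}e^{-\xi A}$ satisfies the dynamical Dirac system $$\psi_x(x,\xi)+\mathrm i j\big(\psi_\xi(x,\xi)+\mathrm i\widetilde V(x)\psi(x,\xi)\big)=0,$$ where $\widetilde V=\begin{bmatrix}0&\widetilde v\\ \widetilde v^*&0\end{bmatrix}$ and $\widetilde v(x)=v(x)+2\Lambda_1(x)^*S(x)^{-1}\Lambda_2(x)$.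
   Context: Here $\mathrm i^2=-1$, $j=\begin{bmatrix}I_p&0\\0&-I_p\end{bmatrix}$, $A^*$ is the conjugate transpose of $A$, $x,\xi$ are real variables, $\psi_x=\frac{\partial}{\partial x}\psi$, $\psi_\xi=\frac{\partial}{\partial\xi}\psi$. *)

theory Defs
  imports "HOL-Analysis.Analysis"
begin

text \<open>An \<open>m \<times> n\<close> complex matrix has type \<open>complex ^ 'n ^ 'm\<close>; matrices with \<open>2p\<close> rows or
  columns are indexed by \<open>'p + 'p\<close>.  On this type \<open>*\<close> and \<open>^\<close> are componentwise, so powers and the
  exponential are taken explicitly with respect to \<open>**\<close>.\<close>

definition mat_scale :: "complex \<Rightarrow> complex ^ 'n ^ 'm \<Rightarrow> complex ^ 'n ^ 'm"
    (infixr "\<cdot>\<^sub>m" 75)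
  where "z \<cdot>\<^sub>m M = (\<chi> i k. z * M $ i $ k)"

definition adj :: "complex ^ 'n ^ 'm \<Rightarrow> complex ^ 'm ^ 'n"
  where "adj M = (\<chi> i k. cnj (M $ k $ i))"

primrec mat_pow :: "complex ^ 'n ^ 'n \<Rightarrow> nat \<Rightarrow> complex ^ 'n ^ 'n"
  where
    "mat_pow M 0 = mat 1"
  | "mat_pow M (Suc k) = M ** mat_pow M k"

definition mat_exp :: "complex ^ 'n ^ 'n \<Rightarrow> complex ^ 'n ^ 'n"
  where "mat_exp M = (\<Sum>k. mat_pow M k /\<^sub>R fact k)"

definition row_block ::
    "complex ^ 'p::finite ^ 'n \<Rightarrow> complex ^ 'q::finite ^ 'n \<Rightarrow> complex ^ ('p + 'q) ^ 'n"
  where "row_block M N = (\<chi> i k. case k of Inl l \<Rightarrow> M $ i $ l | Inr l \<Rightarrow> N $ i $ l)"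

definition four_block ::
    "complex ^ 'p::finite ^ 'r::finite \<Rightarrow> complex ^ 'q::finite ^ 'r \<Rightarrow> complex ^ 'p ^ 's::finite \<Rightarrow> complex ^ 'q ^ 's
      \<Rightarrow> complex ^ ('p + 'q) ^ ('r + 's)"
  where "four_block M\<^sub>1\<^sub>1 M\<^sub>1\<^sub>2 M\<^sub>2\<^sub>1 M\<^sub>2\<^sub>2 =
    (\<chi> i. case i of Inl l \<Rightarrow> row_block M\<^sub>1\<^sub>1 M\<^sub>1\<^sub>2 $ l | Inr l \<Rightarrow> row_block M\<^sub>2\<^sub>1 M\<^sub>2\<^sub>2 $ l)"

definition sig_j :: "complex ^ ('p::finite + 'p) ^ ('p + 'p)"
  where "sig_j = four_block (mat 1) 0 0 (- mat 1)"

definition off_diag :: "complex ^ 'p::finite ^ 'p \<Rightarrow> complex ^ ('p + 'p) ^ ('p + 'p)"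
  where "off_diag w = four_block 0 w (adj w) 0"

text \<open>\<open>\<psi>\<^sub>x + \<i> j (\<psi>\<^sub>\<xi> + W \<psi>) = 0\<close> at the point \<open>(x, \<xi>)\<close>, including the existence of both partial
  derivatives there.\<close>

definition dirac_system_at ::
    "(real \<Rightarrow> complex ^ ('p::finite + 'p) ^ ('p + 'p)) \<Rightarrow> (real \<Rightarrow> real \<Rightarrow> complex ^ 'n ^ ('p + 'p))
      \<Rightarrow> real \<Rightarrow> real \<Rightarrow> bool"
  where "dirac_system_at W \<psi> x \<xi> \<longleftrightarrow>
    (\<exists>\<psi>\<^sub>x \<psi>\<^sub>\<xi>.
      ((\<lambda>t. \<psi> t \<xi>) has_vector_derivative \<psi>\<^sub>x) (at x) \<and>
      ((\<lambda>t. \<psi> x t) has_vector_derivative \<psi>\<^sub>\<xi>) (at \<xi>) \<and>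
      \<psi>\<^sub>x + \<i> \<cdot>\<^sub>m (sig_j ** (\<psi>\<^sub>\<xi> + W x ** \<psi> x \<xi>)) = 0)"

end

theory Submission
  imports Defs "HOL-Computational_Algebra.Fundamental_Theorem_Algebra"
begin

text \<open>Both parts are one computation with \<open>z = 1\<close>, \<open>K = I\<close> in (i) and \<open>z = \<i>\<close>, \<open>K = j\<close> in (ii).
  With \<open>M = - \<i> z\<^sup>* [[0, v], [- v\<^sup>*, 0]]\<close> the choice of \<open>f\<^sub>3, f\<^sub>4\<close> gives \<open>\<Pi>' = - \<i> A \<Pi> j + \<Pi> M\<close>, and
  \<open>S' = \<Pi> K \<Pi>\<^sup>*\<close>.  Since \<open>M K j\<close> is skew-adjoint, \<open>A S - S A\<^sup>* - \<i> \<Pi> K j \<Pi>\<^sup>*\<close> has zero derivative, so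
  the identity assumed at \<open>0\<close> holds for every \<open>x\<close>.  It lets \<open>S\<^sup>-\<^sup>1 A\<close> be replaced by
  \<open>A\<^sup>* S\<^sup>-\<^sup>1\<close> in \<open>\<psi>\<^sub>\<xi>\<close>, and with \<open>X = \<Pi>\<^sup>* S\<^sup>-\<^sup>1 \<Pi>\<close> the system reduces to
  \<open>M\<^sup>* - X K + j X K j + \<i> z j V = 0\<close>, where \<open>V\<close> is the dressed potential, which is the definition
  of the latter.  The square root \<open>Q\<close> is a polynomial in the given invertible matrix.\<close>

section \<open>Bilinear matrix operations and the rules for the adjoint\<close>

lemma bounded_bilinear_matrix_mult:
  "bounded_bilinear ((**) :: complex ^ 'n ^ 'm \<Rightarrow> complex ^ 'k ^ 'n \<Rightarrow> complex ^ 'k ^ 'm)"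
  unfolding bilinear_conv_bounded_bilinear[symmetric] bilinear_def
  by (auto intro!: linearI simp: matrix_matrix_mult_def vec_eq_iff algebra_simps sum.distrib
      scaleR_sum_right)

lemma bounded_bilinear_mat_scale:
  "bounded_bilinear ((\<cdot>\<^sub>m) :: complex \<Rightarrow> complex ^ 'n ^ 'm \<Rightarrow> complex ^ 'n ^ 'm)"
  unfolding bilinear_conv_bounded_bilinear[symmetric] bilinear_def
  by (auto intro!: linearI simp: mat_scale_def vec_eq_iff algebra_simps)

lemma bounded_linear_adj: "bounded_linear (adj :: complex ^ 'n ^ 'm \<Rightarrow> complex ^ 'm ^ 'n)"
  unfolding linear_conv_bounded_linear[symmetric]
  by (auto intro!: linearI simp: adj_def vec_eq_iff)

lemmas matrix_mult_linear =
  bounded_bilinear.add_left[OF bounded_bilinear_matrix_mult]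
  bounded_bilinear.add_right[OF bounded_bilinear_matrix_mult]
  bounded_bilinear.diff_left[OF bounded_bilinear_matrix_mult]
  bounded_bilinear.diff_right[OF bounded_bilinear_matrix_mult]
  bounded_bilinear.minus_left[OF bounded_bilinear_matrix_mult]
  bounded_bilinear.minus_right[OF bounded_bilinear_matrix_mult]

lemmas matrix_mult_zero [simp] =
  bounded_bilinear.zero_left[OF bounded_bilinear_matrix_mult]
  bounded_bilinear.zero_right[OF bounded_bilinear_matrix_mult]

lemmas has_vector_derivative_matrix_mult =
  bounded_bilinear.has_vector_derivative[OF bounded_bilinear_matrix_mult]

lemmas has_vector_derivative_mat_scale =
  bounded_bilinear.has_vector_derivative[OF bounded_bilinear_mat_scale]

lemma mat_scale_nth: "(z \<cdot>\<^sub>m M) $ i $ k = z * M $ i $ k"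
  by (simp add: mat_scale_def)

lemma mat_scale_mult_left: "(z \<cdot>\<^sub>m M) ** N = z \<cdot>\<^sub>m (M ** N)"
  by (simp add: vec_eq_iff mat_scale_def matrix_matrix_mult_def sum_distrib_left algebra_simps)

lemma mat_scale_mult_right: "M ** (z \<cdot>\<^sub>m N) = z \<cdot>\<^sub>m (M ** N)"
  by (simp add: vec_eq_iff mat_scale_def matrix_matrix_mult_def sum_distrib_left algebra_simps)

lemma mat_scale_scale: "z \<cdot>\<^sub>m (w \<cdot>\<^sub>m M) = (z * w) \<cdot>\<^sub>m M"
  by (simp add: vec_eq_iff mat_scale_def)

lemma mat_scale_one [simp]: "1 \<cdot>\<^sub>m M = M"
  by (simp add: vec_eq_iff mat_scale_def)

lemma mat_scale_zero [simp]: "z \<cdot>\<^sub>m 0 = 0"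
  by (simp add: vec_eq_iff mat_scale_def)

lemma of_real_mat_scale: "complex_of_real r \<cdot>\<^sub>m M = r *\<^sub>R M"
  by (simp add: vec_eq_iff mat_scale_def scaleR_conv_of_real[where 'a = complex])

lemma scalar_mat_mult_left: "mat z ** M = z \<cdot>\<^sub>m M"
  by (simp add: vec_eq_iff mat_scale_def mat_def matrix_matrix_mult_def if_distrib if_distribR cong: if_cong)

lemma scalar_mat_mult_right: "M ** mat z = z \<cdot>\<^sub>m M"
  by (simp add: vec_eq_iff mat_scale_def mat_def matrix_matrix_mult_def if_distrib if_distribR mult.commute cong: if_cong)

text \<open>Distributes products over sums, pulls scalars out of products and associates to the
  right. In such a normal form a relation between adjacent factors only fires in a version with a
  trailing factor, which is why facts like \<open>M_left\<close>, \<open>AR_left\<close> and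
  \<open>QQ_left\<close> are prepared below.\<close>

lemmas matrix_expand =
  matrix_mult_linear mat_scale_mult_left mat_scale_mult_right scalar_mat_mult_left
  scalar_mat_mult_right matrix_mul_assoc[symmetric]

text \<open>Unfolding these leaves products of matrices opaque, so that \<open>algebra_simps\<close> can decide
  linear identities between them entrywise.\<close>
lemmas matrix_entries = vec_eq_iff mat_scale_nth

lemma adj_mult: "adj (M ** N) = adj N ** adj M"
  by (simp add: adj_def matrix_matrix_mult_def vec_eq_iff mult.commute)

lemma adj_scale: "adj (z \<cdot>\<^sub>m M) = cnj z \<cdot>\<^sub>m adj M"
  by (simp add: adj_def mat_scale_def vec_eq_iff)

lemma adj_add: "adj (M + N) = adj M + adj N"
  by (simp add: adj_def vec_eq_iff)

lemma adj_diff: "adj (M - N) = adj M - adj N"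
  by (simp add: adj_def vec_eq_iff)

lemma adj_uminus: "adj (- M) = - adj M"
  by (simp add: adj_def vec_eq_iff)

lemma adj_adj [simp]: "adj (adj M) = M"
  by (simp add: adj_def vec_eq_iff)

lemma adj_mat: "adj (mat z) = mat (cnj z)"
  by (simp add: adj_def mat_def vec_eq_iff)

lemma adj_zero [simp]: "adj 0 = 0"
  by (simp add: adj_def vec_eq_iff)

section \<open>Square roots of invertible matrices\<close>

text \<open>Evaluation by Horner's scheme with respect to \<open>**\<close>; \<open>poly\<close>
  would use the componentwise product of the type.\<close>

definition mat_poly :: "complex poly \<Rightarrow> complex ^ 'n ^ 'n \<Rightarrow> complex ^ 'n ^ 'n"
  where "mat_poly p M = fold_coeffs (\<lambda>a N. mat a + M ** N) p 0"

lemma mat_poly_0 [simp]: "mat_poly 0 M = 0"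
  by (simp add: mat_poly_def)

lemma mat_zero [simp]: "mat 0 = (0 :: 'a::zero ^ 'n ^ 'n)"
  by (simp add: mat_def vec_eq_iff)

lemma mat_poly_pCons [simp]: "mat_poly (pCons a p) M = mat a + M ** mat_poly p M"
  by (cases "p = 0 \<and> a = 0") (auto simp: mat_poly_def)

lemma mat_add: "mat (a + b) = (mat a + mat b :: 'a::monoid_add ^ 'n ^ 'n)"
  by (simp add: mat_def vec_eq_iff)

lemma mat_poly_add: "mat_poly (p + q) M = mat_poly p M + mat_poly q M"
  by (induction p q rule: poly_induct2) (simp_all add: mat_add matrix_mult_linear)

lemma mat_poly_smult: "mat_poly (smult z p) M = z \<cdot>\<^sub>m mat_poly p M"
  by (induction p) (simp_all add: matrix_expand, simp_all add: matrix_entries mat_def algebra_simps)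

lemma mat_poly_mult: "mat_poly (p * q) M = mat_poly p M ** mat_poly q M"
  by (induction p) (simp_all add: mat_poly_add mat_poly_smult matrix_expand)

lemma mat_poly_diff: "mat_poly (p - q) M = mat_poly p M - mat_poly q M"
  using mat_poly_add[of "p - q" q M] by (simp add: algebra_simps)

lemma mat_poly_commute:
  assumes "A ** M = M ** A"
  shows "A ** mat_poly p M = mat_poly p M ** A"
proof (induction p)
  case (pCons a p)
  have "A ** (M ** mat_poly p M) = M ** (A ** mat_poly p M)"
    by (metis assms matrix_mul_assoc)
  then show ?case by (simp add: matrix_expand pCons)
qed simp

lemma mat_poly_monom: "mat_poly (monom a k) M = a \<cdot>\<^sub>m mat_pow M k"
  by (induction k) (auto simp: monom_0 monom_Suc matrix_expand, simp add: matrix_entries mat_def)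

lemma mat_poly_sum: "mat_poly (sum f I) M = (\<Sum>i\<in>I. mat_poly (f i) M)"
  by (induction I rule: infinite_finite_induct) (simp_all add: mat_poly_add)

text \<open>Matrices form a real space of finite dimension, so one power more than the dimension
  gives a linear dependence. Dependence is a property of sets, hence two equal powers are treated
  apart, with the difference of the two monomials as polynomial.\<close>

lemma exists_annihilating_poly:
  fixes M :: "complex ^ 'n ^ 'n"
  shows "\<exists>p. p \<noteq> 0 \<and> mat_poly p M = 0"
proof (cases "inj (mat_pow M)")
  case False
  then obtain k l where kl: "mat_pow M k = mat_pow M l" "k \<noteq> l"
    by (auto simp: inj_def)
  let ?p = "monom (1::complex) k - monom 1 l"
  have "coeff ?p k = 1" using kl(2) by simp
  then have "?p \<noteq> 0" by (metis coeff_0 zero_neq_one)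
  moreover have "mat_poly ?p M = 0"
    by (simp add: mat_poly_diff mat_poly_monom kl(1))
  ultimately show ?thesis by blast
next
  case True
  let ?d = "DIM(complex ^ 'n ^ 'n)"
  let ?S = "mat_pow M ` {..?d}"
  have "card ?S = Suc ?d"
    using True by (subst card_image) (auto intro: inj_on_subset)
  then have "dependent ?S"
    by (intro dependent_biggerset) auto
  then obtain u v where uv: "v \<in> ?S" "u v \<noteq> 0" "(\<Sum>v\<in>?S. u v *\<^sub>R v) = 0"
    using dependent_finite[of ?S] by auto
  let ?p = "\<Sum>k\<le>?d. monom (complex_of_real (u (mat_pow M k))) k"
  obtain k where k: "k \<le> ?d" "v = mat_pow M k" using uv(1) by auto
  have "coeff ?p k = (\<Sum>l\<le>?d. if l = k then complex_of_real (u (mat_pow M l)) else 0)"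
    by (simp add: coeff_sum)
  also have "\<dots> = complex_of_real (u v)"
    using k by (subst sum.delta) auto
  finally have "?p \<noteq> 0" using uv(2)
    by (metis coeff_0 of_real_eq_0_iff)
  moreover have "mat_poly ?p M = (\<Sum>k\<le>?d. u (mat_pow M k) *\<^sub>R mat_pow M k)"
    by (simp add: mat_poly_sum mat_poly_monom of_real_mat_scale)
  moreover have "\<dots> = (\<Sum>v\<in>?S. u v *\<^sub>R v)"
    using True by (subst sum.reindex) (auto intro: inj_on_subset)
  ultimately show ?thesis using uv(3) by metis
qed

section \<open>The square root of the indeterminate modulo a polynomial\<close>

lemma complex_quadratic_solvable:
  fixes a b c :: complex
  assumes "a \<noteq> 0 \<or> b \<noteq> 0"
  shows "\<exists>t. c + b * t + a * t\<^sup>2 = 0"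
proof (cases "a = 0")
  case True
  then show ?thesis using assms by (intro exI[of _ "- c / b"]) auto
next
  case False
  have "\<not> constant (poly [:c, b, a:])"
    using False by (simp add: constant_degree)
  then obtain t where "poly [:c, b, a:] t = 0"
    using fundamental_theorem_of_algebra by blast
  then show ?thesis by (intro exI[of _ t]) (simp add: algebra_simps power2_eq_square)
qed

text \<open>Factor by factor: a square root \<open>p\<close> of \<open>X\<close> modulo \<open>r\<close> is corrected to \<open>p + t r\<close> modulo
  \<open>(X - z) r\<close>, where the constant \<open>t\<close> solves a quadratic equation.  That equation can only
  degenerate if \<open>r\<close> and \<open>p\<close> both vanish at \<open>z\<close>, which forces \<open>z = 0\<close>.\<close>
lemma exists_poly_sqrt_mod:
  fixes m :: "complex poly"
  assumes "poly m 0 \<noteq> 0"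
  shows "\<exists>p. m dvd p * p - [:0, 1:]"
  using assms
proof (induction "degree m" arbitrary: m)
  case 0
  then obtain e where "m = [:e:]" by (metis degree_eq_zeroE)
  with 0 have "is_unit m" by (simp add: is_unit_iff_degree)
  then show ?case by (intro exI) (rule unit_imp_dvd)
next
  case (Suc d)
  have "\<not> constant (poly m)" using Suc.hyps by (simp add: constant_degree)
  then obtain z where "poly m z = 0" using fundamental_theorem_of_algebra by blast
  then obtain r where m: "m = [:- z, 1:] * r" by (metis poly_eq_0_iff_dvd dvdE)
  have r0: "poly r 0 \<noteq> 0" and z0: "z \<noteq> 0" using Suc.prems by (auto simp: m)
  have "r \<noteq> 0" using r0 by auto
  then have "degree m = Suc (degree r)" unfolding m by (subst degree_mult_eq) auto
  then have "d = degree r" using Suc.hyps by simp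
  then obtain p q where pq: "p * p - [:0, 1:] = r * q"
    using Suc.hyps(1) r0 by (metis dvdE)
  from arg_cong[OF this, of "\<lambda>f. poly f z"]
  have pqz: "poly p z * poly p z - z = poly r z * poly q z" by simp
  have "poly r z \<noteq> 0 \<or> 2 * poly p z \<noteq> 0" using pqz z0 by auto
  then obtain t where "poly q z + 2 * poly p z * t + poly r z * t\<^sup>2 = 0"
    using complex_quadratic_solvable by blast
  then have "poly (q + smult (2 * t) p + smult (t\<^sup>2) r) z = 0"
    by (simp add: algebra_simps)
  then obtain s where s: "q + smult (2 * t) p + smult (t\<^sup>2) r = [:- z, 1:] * s"
    by (metis poly_eq_0_iff_dvd dvdE)
  have "(p + smult t r) * (p + smult t r) - [:0, 1:]
      = (p * p - [:0, 1:]) + r * (smult (2 * t) p + smult (t\<^sup>2) r)"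
    by (subst poly_eq_poly_eq_iff[symmetric]) (simp add: fun_eq_iff algebra_simps power2_eq_square)
  also have "\<dots> = r * (q + smult (2 * t) p + smult (t\<^sup>2) r)"
    by (simp add: pq algebra_simps)
  also have "\<dots> = m * s" unfolding s m by (simp only: mult_ac)
  finally show ?case by (metis dvd_triv_left)
qed

text \<open>Let \<open>m\<close> annihilate \<open>B\<close> with least degree. Invertibility of
  \<open>B\<close> makes its constant term nonzero, so the indeterminate has a square root
  \<open>p\<close> modulo \<open>m\<close>, and evaluating at \<open>B\<close> kills the multiple of
  \<open>m\<close>.\<close>

lemma exists_matrix_sqrt:
  fixes B :: "complex ^ 'n ^ 'n"
  assumes "det B \<noteq> 0"
  obtains p where "mat_poly p B ** mat_poly p B = B"
proof -
  obtain m where m: "m \<noteq> 0" "mat_poly m B = 0"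
    and least: "\<And>q. q \<noteq> 0 \<Longrightarrow> mat_poly q B = 0 \<Longrightarrow> degree m \<le> degree q"
    using exists_annihilating_poly[of B]
      ex_has_least_nat[of "\<lambda>p. p \<noteq> 0 \<and> mat_poly p B = 0" _ degree] by blast
  \<comment> \<open>Otherwise \<open>m\<close> is the indeterminate times some \<open>q\<close>, and
    cancelling the invertible factor \<open>B\<close> leaves \<open>q\<close> as an annihilator of
    smaller degree.\<close>
  have "poly m 0 \<noteq> 0"
  proof
    assume "poly m 0 = 0"
    then obtain q where q: "m = pCons 0 q"
      by (cases m) auto
    obtain C where "C ** B = mat 1"
      using assms invertible_det_nz[of B] unfolding invertible_def by blast
    moreover have "B ** mat_poly q B = 0" using m(2) by (simp add: q)
    ultimately have "mat_poly q B = 0"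
      by (metis matrix_mul_assoc matrix_mul_lid matrix_mult_zero(2))
    moreover have "q \<noteq> 0" using m(1) q by auto
    ultimately have "degree m \<le> degree q" by (rule least[rotated])
    then show False using q \<open>q \<noteq> 0\<close> by simp
  qed
  then obtain p s where "p * p - [:0, 1:] = m * s"
    using exists_poly_sqrt_mod by (metis dvdE)
  from arg_cong[OF this, of "\<lambda>f. mat_poly f B"]
  have "mat_poly p B ** mat_poly p B = B"
    by (simp add: mat_poly_diff mat_poly_mult m(2))
  then show thesis by (rule that)
qed

text \<open>The root is a polynomial in \<open>B\<close> and so commutes with everything that
  commutes with \<open>B\<close>.\<close>

lemma exists_commuting_sqrt:
  fixes A B :: "complex ^ 'n ^ 'n"
  assumes "det B \<noteq> 0" and "A ** B = B ** A"
  shows "\<exists>Q. A ** Q = Q ** A \<and> Q ** Q = B"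
proof -
  obtain p where "mat_poly p B ** mat_poly p B = B"
    using exists_matrix_sqrt[OF assms(1)] .
  then show ?thesis using mat_poly_commute[OF assms(2), of p] by blast
qed

section \<open>The matrix exponential and the inverse matrix as functions\<close>

lemma has_vector_derivative_vecI:
  fixes f :: "real \<Rightarrow> 'a::real_normed_vector ^ 'n"
  assumes "\<And>i. ((\<lambda>t. f t $ i) has_vector_derivative f' $ i) (at x within s)"
  shows "(f has_vector_derivative f') (at x within s)"
  unfolding has_vector_derivative_def has_derivative_within
proof (intro conjI vec_tendstoI)
  show "bounded_linear (\<lambda>x. x *\<^sub>R f')"
    by (rule bounded_linear_scaleR_left)
  fix i
  show "((\<lambda>y. ((1 / norm (y - x)) *\<^sub>R (f y - (f x + (y - x) *\<^sub>R f'))) $ i) \<longlongrightarrow> 0 $ i) (at x within s)"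
    using assms[of i] by (simp add: has_vector_derivative_def has_derivative_within)
qed

lemma has_vector_derivative_vec_nth:
  assumes "(f has_vector_derivative f') F"
  shows "((\<lambda>t. f t $ i) has_vector_derivative f' $ i) F"
  using bounded_linear.has_vector_derivative[OF bounded_linear_vec_nth assms] .

lemma sums_vecI:
  fixes f :: "nat \<Rightarrow> 'a::real_normed_vector ^ 'n"
  assumes "\<And>i. (\<lambda>k. f k $ i) sums (s $ i)"
  shows "f sums s"
  using assms unfolding sums_def by (intro vec_tendstoI) simp

section \<open>Convergence and derivative of the matrix exponential\<close>

lemma mat_pow_mat_scale: "mat_pow (z \<cdot>\<^sub>m M) k = z ^ k \<cdot>\<^sub>m mat_pow M k"
  by (induction k) (simp_all add: matrix_expand mat_scale_scale mult.commute)

lemma mat_pow_entry_bound: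
  fixes M :: "complex ^ 'n ^ 'n"
  obtains C where "\<And>k i j. cmod (mat_pow M k $ i $ j) \<le> C ^ k"
proof -
  define b where "b = (\<Sum>i\<in>UNIV. \<Sum>j\<in>UNIV. cmod (M $ i $ j))"
  have b: "cmod (M $ i $ j) \<le> b" for i j
  proof -
    have "cmod (M $ i $ j) \<le> (\<Sum>j\<in>UNIV. cmod (M $ i $ j))"
      by (rule member_le_sum) auto
    also have "\<dots> \<le> b" unfolding b_def
      by (rule member_le_sum[where f = "\<lambda>i. \<Sum>j\<in>UNIV. cmod (M $ i $ j)"]) (auto intro: sum_nonneg)
    finally show ?thesis .
  qed
  \<comment> \<open>\<open>undefined\<close> serves as an arbitrary index: any entry shows that
    \<open>b\<close> is nonnegative.\<close>
  have b0: "0 \<le> b" using b[of undefined undefined] norm_ge_zero order_trans by blast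
  \<comment> \<open>Each further factor \<open>M\<close> produces a sum of \<open>CARD('n)\<close>
    terms, each bounded by \<open>b\<close> times the previous bound.\<close>
  have "cmod (mat_pow M k $ i $ j) \<le> (of_nat CARD('n) * b) ^ k" for k i j
  proof (induction k arbitrary: i)
    case (Suc k)
    have "cmod (mat_pow M (Suc k) $ i $ j) \<le> (\<Sum>l\<in>UNIV. cmod (M $ i $ l) * cmod (mat_pow M k $ l $ j))"
      by (simp add: matrix_matrix_mult_def norm_mult[symmetric] norm_sum)
    also have "\<dots> \<le> (\<Sum>l\<in>(UNIV :: 'n set). b * (of_nat CARD('n) * b) ^ k)"
      using b b0 Suc by (intro sum_mono mult_mono) auto
    finally show ?case by (simp add: algebra_simps)
  qed (simp add: mat_def)
  then show thesis by (rule that)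
qed

text \<open>Dominated by the exponential series at \<open>C * cmod z\<close>. The complex variable
  \<open>z\<close> is carried along so that the entries are power series that can be differentiated
  termwise.\<close>

lemma summable_mat_exp_entry:
  "summable (\<lambda>k. mat_pow M k $ i $ j / fact k * z ^ k)"
proof -
  obtain C where C: "\<And>k i j. cmod (mat_pow M k $ i $ j) \<le> C ^ k"
    using mat_pow_entry_bound[of M] by blast
  show ?thesis
  proof (rule summable_comparison_test'[OF summable_exp[of "C * cmod z"], of 0])
    fix k
    have "cmod (mat_pow M k $ i $ j) * cmod z ^ k \<le> C ^ k * cmod z ^ k"
      by (intro mult_right_mono C) auto
    then show "cmod (mat_pow M k $ i $ j / fact k * z ^ k) \<le> inverse (fact k) * (C * cmod z) ^ k"
      by (simp add: norm_mult norm_divide norm_power power_mult_distrib field_simps)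
  qed
qed

text \<open>The series in the definition of \<open>mat_exp\<close> is a genuine limit: it converges
  entry by entry.\<close>

lemma mat_exp_sums: "(\<lambda>k. mat_pow M k /\<^sub>R fact k) sums mat_exp M"
proof -
  have "(\<lambda>k. mat_pow M k /\<^sub>R fact k) sums (\<chi> i j. \<Sum>k. mat_pow M k $ i $ j / fact k)"
    using summable_mat_exp_entry[of M _ _ 1]
    by (intro sums_vecI) (simp add: summable_sums scaleR_conv_of_real[where 'a = complex] field_simps)
  then show ?thesis
    unfolding mat_exp_def by (simp add: sums_iff)
qed

lemma mat_exp_entry_sums:
  "(\<lambda>k. mat_pow M k $ i $ j / fact k * z ^ k) sums (mat_exp (z \<cdot>\<^sub>m M) $ i $ j)"
proof -
  have "(\<lambda>k. (mat_pow (z \<cdot>\<^sub>m M) k /\<^sub>R fact k) $ i $ j) sums (mat_exp (z \<cdot>\<^sub>m M) $ i $ j)"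
    by (intro bounded_linear.sums[OF bounded_linear_vec_nth] mat_exp_sums)
  then show ?thesis
    by (simp add: mat_pow_mat_scale scaleR_conv_of_real[where 'a = complex] mat_scale_nth field_simps)
qed

lemma mat_exp_commute:
  assumes "A ** M = M ** A"
  shows "A ** mat_exp M = mat_exp M ** A"
proof -
  have comm: "A ** mat_pow M k = mat_pow M k ** A" for k
    by (induction k) (simp_all, metis assms matrix_mul_assoc)
  note bb = bounded_bilinear_matrix_mult
  have "(\<lambda>k. A ** (mat_pow M k /\<^sub>R fact k)) sums (A ** mat_exp M)"
    by (intro bounded_linear.sums[OF bounded_bilinear.bounded_linear_right[OF bb]] mat_exp_sums)
  moreover have "(\<lambda>k. (mat_pow M k /\<^sub>R fact k) ** A) sums (mat_exp M ** A)"
    by (intro bounded_linear.sums[OF bounded_bilinear.bounded_linear_left[OF bb]] mat_exp_sums)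
  ultimately show ?thesis
    by (simp add: bounded_bilinear.scaleR_left[OF bb] bounded_bilinear.scaleR_right[OF bb] comm sums_unique2)
qed

text \<open>Termwise differentiation of an everywhere convergent power series: the shifted
  coefficient \<open>diffs c k\<close> is the entry of \<open>M ** mat_pow M k\<close> divided by
  \<open>fact k\<close>.\<close>

lemma mat_exp_entry_has_field_derivative:
  "((\<lambda>z. mat_exp (z \<cdot>\<^sub>m M) $ i $ j) has_field_derivative (M ** mat_exp (z \<cdot>\<^sub>m M)) $ i $ j) (at z)"
proof -
  define c where "c = (\<lambda>k. mat_pow M k $ i $ j / fact k)"
  have "((\<lambda>z. \<Sum>k. c k * z ^ k) has_field_derivative (\<Sum>k. diffs c k * z ^ k)) (at z)"
    unfolding c_def by (rule termdiffs_strong_converges_everywhere) (rule summable_mat_exp_entry)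
  moreover have "(\<lambda>k. diffs c k * z ^ k) sums ((M ** mat_exp (z \<cdot>\<^sub>m M)) $ i $ j)"
  proof -
    have "(\<lambda>k. \<Sum>l\<in>UNIV. M $ i $ l * (mat_pow M k $ l $ j / fact k * z ^ k)) sums
        (\<Sum>l\<in>UNIV. M $ i $ l * mat_exp (z \<cdot>\<^sub>m M) $ l $ j)"
      by (intro sums_sum sums_mult mat_exp_entry_sums)
    moreover have "diffs c k * z ^ k = (\<Sum>l\<in>UNIV. M $ i $ l * (mat_pow M k $ l $ j / fact k * z ^ k))" for k
    proof -
      have "diffs c k = (M ** mat_pow M k) $ i $ j / fact k"
        by (simp add: diffs_def c_def divide_simps del: of_nat_Suc)
      then show ?thesis
        by (simp add: matrix_matrix_mult_def sum_distrib_left sum_distrib_right sum_divide_distrib mult.assoc)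
    qed
    ultimately show ?thesis by (simp add: matrix_matrix_mult_def)
  qed
  moreover have "(\<lambda>z. mat_exp (z \<cdot>\<^sub>m M) $ i $ j) = (\<lambda>z. \<Sum>k. c k * z ^ k)"
    unfolding c_def by (rule ext) (rule sums_unique[OF mat_exp_entry_sums])
  ultimately show ?thesis by (simp add: sums_iff)
qed

text \<open>The complex weight \<open>w\<close> covers the exponents \<open>\<i> x Q\<close> and
  \<open>- \<i> x Q\<close> of the initial solution as well as \<open>- \<xi> A\<close>.\<close>

lemma mat_exp_has_vector_derivative:
  "((\<lambda>t. mat_exp ((w * complex_of_real t) \<cdot>\<^sub>m M)) has_vector_derivative
     w \<cdot>\<^sub>m (M ** mat_exp ((w * complex_of_real t) \<cdot>\<^sub>m M))) (at t)"
proof (intro has_vector_derivative_vecI)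
  fix i j
  have "((\<lambda>t. w * complex_of_real t) has_vector_derivative w) (at t)"
    by (auto intro!: derivative_eq_intros)
  from field_vector_diff_chain_at[OF this mat_exp_entry_has_field_derivative]
  show "((\<lambda>t. mat_exp ((w * complex_of_real t) \<cdot>\<^sub>m M) $ i $ j) has_vector_derivative
     (w \<cdot>\<^sub>m (M ** mat_exp ((w * complex_of_real t) \<cdot>\<^sub>m M))) $ i $ j) (at t)"
    by (simp add: o_def mat_scale_nth)
qed

section \<open>Continuity and derivative of the inverse matrix\<close>

lemma invertible_matrix_inv:
  fixes S :: "complex ^ 'n ^ 'n"
  assumes "invertible S"
  shows "S ** matrix_inv S = mat 1" and "matrix_inv S ** S = mat 1"
  using assms someI_ex[of "\<lambda>R. S ** R = mat 1 \<and> R ** S = mat 1"]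
  unfolding invertible_def matrix_inv_def by auto

lemma adj_matrix_inv:
  fixes S :: "complex ^ 'n ^ 'n"
  assumes "invertible S" and "adj S = S"
  shows "adj (matrix_inv S) = matrix_inv S"
proof -
  have "adj (matrix_inv S) ** S = mat 1"
    using arg_cong[OF invertible_matrix_inv(1)[OF assms(1)], of adj] assms(2)
    by (simp add: adj_mult adj_mat)
  then show ?thesis
    by (metis assms(1) invertible_matrix_inv(1) matrix_mul_assoc matrix_mul_lid matrix_mul_rid)
qed

lemma tendsto_det:
  fixes S :: "'b \<Rightarrow> complex ^ 'n ^ 'n"
  assumes "(S \<longlongrightarrow> S0) F"
  shows "((\<lambda>t. det (S t)) \<longlongrightarrow> det S0) F"
  unfolding det_def by (intro tendsto_intros assms)

text \<open>Cramer's rule applied to the columns of the inverse. Its entries become quotients of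
  determinants, from which continuity of the inverse follows.\<close>

lemma matrix_inv_entry:
  fixes S :: "complex ^ 'n ^ 'n"
  assumes "det S \<noteq> 0"
  shows "matrix_inv S $ i $ k = det (\<chi> r s. if s = i then axis k 1 $ r else S $ r $ s) / det S"
proof -
  have "S ** matrix_inv S = mat 1"
    using assms by (simp add: invertible_matrix_inv invertible_det_nz)
  then have "S *v (\<chi> i. matrix_inv S $ i $ k) = axis k 1"
    by (simp add: vec_eq_iff matrix_vector_mult_def matrix_matrix_mult_def mat_def axis_def)
  then have "(\<chi> i. matrix_inv S $ i $ k) =
      (\<chi> i. det (\<chi> r s. if s = i then axis k 1 $ r else S $ r $ s) / det S)"
    by (simp only: cramer[OF assms])
  then show ?thesis by (simp add: vec_eq_iff)
qed

lemma tendsto_matrix_inv: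
  fixes S :: "'b \<Rightarrow> complex ^ 'n ^ 'n"
  assumes S: "(S \<longlongrightarrow> S0) F" and "invertible S0"
  shows "((\<lambda>t. matrix_inv (S t)) \<longlongrightarrow> matrix_inv S0) F" and "\<forall>\<^sub>F t in F. invertible (S t)"
proof -
  have d0: "det S0 \<noteq> 0" using assms(2) by (simp add: invertible_det_nz)
  have ev: "\<forall>\<^sub>F t in F. det (S t) \<noteq> 0"
    using tendsto_det[OF S] d0 by (rule tendsto_imp_eventually_ne)
  then show "\<forall>\<^sub>F t in F. invertible (S t)" by (simp add: invertible_det_nz)
  show "((\<lambda>t. matrix_inv (S t)) \<longlongrightarrow> matrix_inv S0) F"
  proof (intro vec_tendstoI)
    fix i k
    let ?N = "\<lambda>T :: complex ^ 'n ^ 'n. \<chi> r s. if s = i then axis k 1 $ r else T $ r $ s"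
    have "((\<lambda>t. ?N (S t)) \<longlongrightarrow> ?N S0) F"
      by (intro tendsto_vec_lambda) (auto intro!: tendsto_intros S)
    then have "((\<lambda>t. det (?N (S t)) / det (S t)) \<longlongrightarrow> det (?N S0) / det S0) F"
      by (intro tendsto_divide tendsto_det S d0)
    moreover have "\<forall>\<^sub>F t in F. det (?N (S t)) / det (S t) = matrix_inv (S t) $ i $ k"
      using ev by eventually_elim (simp add: matrix_inv_entry)
    ultimately show "((\<lambda>t. matrix_inv (S t) $ i $ k) \<longlongrightarrow> matrix_inv S0 $ i $ k) F"
      unfolding matrix_inv_entry[OF d0] by (rule Lim_transform_eventually)
  qed
qed

text \<open>The limit form of the derivative, suited to the inverse matrix, whose difference
  quotient has a closed expression.\<close>

lemma has_vector_derivative_iff_quotient: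
  "(f has_vector_derivative f') (at x) \<longleftrightarrow> ((\<lambda>y. (f y - f x) /\<^sub>R (y - x)) \<longlongrightarrow> f') (at x)"
proof -
  have "norm ((f y - f x) /\<^sub>R (y - x) - f') = norm (f y - f x - (y - x) *\<^sub>R f') / norm (y - x)"
    if "y \<noteq> x" for y
  proof -
    have "(f y - f x) /\<^sub>R (y - x) - f' = (f y - f x - (y - x) *\<^sub>R f') /\<^sub>R (y - x)"
      using that by (simp add: scaleR_diff_right)
    then show ?thesis by (simp add: divide_inverse mult.commute)
  qed
  then have ev: "\<forall>\<^sub>F y in at x. norm ((f y - f x) /\<^sub>R (y - x) - f') = norm (f y - f x - (y - x) *\<^sub>R f') / norm (y - x)"
    by (auto simp: eventually_at_filter)
  have "((\<lambda>y. (f y - f x) /\<^sub>R (y - x)) \<longlongrightarrow> f') (at x)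
      \<longleftrightarrow> ((\<lambda>y. norm ((f y - f x) /\<^sub>R (y - x) - f')) \<longlongrightarrow> 0) (at x)"
    by (subst Lim_null) (simp only: tendsto_norm_zero_iff)
  also have "\<dots> \<longleftrightarrow> ((\<lambda>y. norm (f y - f x - (y - x) *\<^sub>R f') / norm (y - x)) \<longlongrightarrow> 0) (at x)"
    by (rule tendsto_cong[OF ev])
  finally show ?thesis
    unfolding has_vector_derivative_def has_derivative_iff_norm
    by (simp add: bounded_linear_scaleR_left)
qed

text \<open>Near \<open>x\<close>, where \<open>S y\<close> stays invertible, the difference of the
  inverses at \<open>y\<close> and \<open>x\<close> is
  \<open>- (matrix_inv (S y) ** (S y - S x) ** matrix_inv (S x))\<close>. Division by
  \<open>y - x\<close> and continuity of the inverse give the limit.\<close>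

lemma has_vector_derivative_matrix_inv:
  fixes S :: "real \<Rightarrow> complex ^ 'n ^ 'n"
  assumes S: "(S has_vector_derivative S') (at x)" and inv: "invertible (S x)"
  shows "((\<lambda>t. matrix_inv (S t)) has_vector_derivative - (matrix_inv (S x) ** S' ** matrix_inv (S x))) (at x)"
proof -
  note bb = bounded_bilinear_matrix_mult
  have "isCont S x" using S by (rule has_vector_derivative_continuous)
  then have lim: "(S \<longlongrightarrow> S x) (at x)" by (simp add: isCont_def)
  note R = tendsto_matrix_inv[OF lim inv]
  have "((\<lambda>y. - (matrix_inv (S y) ** ((S y - S x) /\<^sub>R (y - x)) ** matrix_inv (S x)))
      \<longlongrightarrow> - (matrix_inv (S x) ** S' ** matrix_inv (S x))) (at x)"
    using S unfolding has_vector_derivative_iff_quotient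
    by (intro tendsto_minus bounded_bilinear.tendsto[OF bb] R(1) tendsto_const)
  moreover have "\<forall>\<^sub>F y in at x. - (matrix_inv (S y) ** ((S y - S x) /\<^sub>R (y - x)) ** matrix_inv (S x))
      = (matrix_inv (S y) - matrix_inv (S x)) /\<^sub>R (y - x)"
    using R(2)
  proof eventually_elim
    case (elim y)
    have "matrix_inv (S y) ** (S y - S x) ** matrix_inv (S x) = matrix_inv (S x) - matrix_inv (S y)"
      by (simp add: matrix_mult_linear invertible_matrix_inv[OF elim])
        (simp add: matrix_mul_assoc[symmetric] invertible_matrix_inv[OF inv])
    then show ?case
      by (simp add: bounded_bilinear.scaleR_left[OF bb] bounded_bilinear.scaleR_right[OF bb]
          scaleR_minus_right[symmetric] del: scaleR_minus_right)
  qed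
  ultimately show ?thesis
    unfolding has_vector_derivative_iff_quotient by (rule Lim_transform_eventually)
qed

section \<open>The dressed solution\<close>

lemma has_vector_derivative_interval_integral:
  fixes f :: "real \<Rightarrow> 'a::euclidean_space"
  assumes "continuous_on UNIV f"
  shows "((\<lambda>u. LBINT r=0..ereal u. f r) has_vector_derivative f x) (at x)"
proof -
  \<comment> \<open>The interval contains 0 for either sign of \<open>x\<close>, and the margin of 1
    places \<open>x\<close> in its interior, so the derivative within the interval is the full
    one.\<close>
  define a where "a = min 0 x - 1"
  define b where "b = max 0 x + 1"
  have "((\<lambda>u. LBINT r=ereal 0..ereal u. f r) has_vector_derivative f x) (at x within {a..b})"
    by (rule interval_integral_FTC2) (auto simp: a_def b_def intro: continuous_on_subset[OF assms])
  moreover have "at x within {a..b} = at x"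
    by (rule at_within_Icc_at) (auto simp: a_def b_def)
  ultimately show ?thesis by (simp add: zero_ereal_def)
qed

lemma has_vector_derivative_zero_imp_eq:
  fixes f :: "real \<Rightarrow> 'a::real_normed_vector"
  assumes "\<And>x. (f has_vector_derivative 0) (at x)"
  shows "f x = f y"
  using has_vector_derivative_zero_constant[of UNIV f] assms by (metis UNIV_I convex_UNIV)

text \<open>The algebra common to both cases, free of blocks: \<open>J\<close> stands for j,
  \<open>P\<close> for \<Pi>, and \<open>K\<close> is the weight in the integral defining
  \<open>S\<close>. As \<open>J\<close> and \<open>K\<close> are self-adjoint and commute, the
  assumption on \<open>M\<close> says that \<open>M x ** K ** J\<close> is skew-adjoint.\<close>

locale dressing =
  fixes A :: "complex ^ 'n ^ 'n" and J K :: "complex ^ 'm ^ 'm"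
    and P :: "real \<Rightarrow> complex ^ 'm ^ 'n" and M :: "real \<Rightarrow> complex ^ 'm ^ 'm"
    and S :: "real \<Rightarrow> complex ^ 'n ^ 'n"
  assumes J: "J ** J = mat 1" "adj J = J"
    and K: "adj K = K" "J ** K = K ** J"
    and P_deriv: "\<And>x. (P has_vector_derivative (- \<i>) \<cdot>\<^sub>m (A ** P x ** J) + P x ** M x) (at x)"
    and M: "\<And>x. M x ** K ** J = - (K ** J ** adj (M x))"
    and S_integral: "\<And>x. S x = S 0 + (LBINT r=0..ereal x. P r ** K ** adj (P r))"
    and S0_adj: "adj (S 0) = S 0"
    and S0_identity: "A ** S 0 - S 0 ** adj A = \<i> \<cdot>\<^sub>m (P 0 ** K ** J ** adj (P 0))"
begin

lemma JJ_left: "J ** (J ** X) = X"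
  by (simp add: matrix_mul_assoc J)

lemma JK_left: "J ** (K ** X) = K ** (J ** X)"
  by (simp add: matrix_mul_assoc K)

lemma M_left: "M x ** (K ** (J ** X)) = - (K ** (J ** (adj (M x) ** X)))"
  using arg_cong[OF M[of x], of "\<lambda>Y. Y ** X"] by (simp add: matrix_expand)

lemma adj_P_deriv:
  "((\<lambda>x. adj (P x)) has_vector_derivative \<i> \<cdot>\<^sub>m (J ** adj (P x) ** adj A) + adj (M x) ** adj (P x)) (at x)"
  using bounded_linear.has_vector_derivative[OF bounded_linear_adj P_deriv[of x]]
  by (simp add: adj_add adj_scale adj_mult J matrix_mul_assoc)

lemma S_deriv: "(S has_vector_derivative P x ** K ** adj (P x)) (at x)"
proof -
  have "continuous_on UNIV P" "continuous_on UNIV (\<lambda>x. adj (P x))"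
    using P_deriv adj_P_deriv
    by (auto intro!: continuous_at_imp_continuous_on has_vector_derivative_continuous)
  then have "continuous_on UNIV (\<lambda>x. P x ** K ** adj (P x))"
    by (intro bounded_bilinear.continuous_on[OF bounded_bilinear_matrix_mult] continuous_on_const)
  then have "((\<lambda>x. S 0 + (LBINT r=0..ereal x. P r ** K ** adj (P r))) has_vector_derivative
      0 + P x ** K ** adj (P x)) (at x)"
    by (intro has_vector_derivative_add has_vector_derivative_const has_vector_derivative_interval_integral)
  then show ?thesis by (simp flip: S_integral)
qed

text \<open>The derivative of \<open>S\<close> is self-adjoint because \<open>K\<close> is, so the
  defect \<open>adj (S x) - S x\<close> stays at its initial value 0.\<close>

lemma S_adj: "adj (S x) = S x"
proof -
  have "((\<lambda>x. adj (S x) - S x) has_vector_derivative 0) (at x)" for x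
    using has_vector_derivative_diff[OF bounded_linear.has_vector_derivative[OF bounded_linear_adj S_deriv] S_deriv, of x]
    by (simp add: adj_mult K matrix_mul_assoc)
  then have "adj (S x) - S x = adj (S 0) - S 0" by (rule has_vector_derivative_zero_imp_eq)
  then show ?thesis by (simp add: S0_adj)
qed

text \<open>When the difference \<open>?D\<close> of the two sides is differentiated, the terms with
  \<open>A\<close> and \<open>adj A\<close> cancel because \<open>J ** K ** J = K\<close>, and those
  with \<open>M\<close> cancel by skew-adjointness.\<close>

lemma S_identity: "A ** S x - S x ** adj A = \<i> \<cdot>\<^sub>m (P x ** K ** J ** adj (P x))"
proof -
  let ?D = "\<lambda>x. A ** S x - S x ** adj A - \<i> \<cdot>\<^sub>m (P x ** K ** J ** adj (P x))"
  have "(?D has_vector_derivative 0) (at x)" for x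
  proof (rule has_vector_derivative_eq_rhs)
    \<comment> \<open>The derivative is spelled out exactly as the product rules produce it,
      including the zero derivatives of constant factors.\<close>
    show "(?D has_vector_derivative
        (A ** (P x ** K ** adj (P x)) + 0 ** S x) - (S x ** 0 + (P x ** K ** adj (P x)) ** adj A)
        - (\<i> \<cdot>\<^sub>m (P x ** K ** J ** (\<i> \<cdot>\<^sub>m (J ** adj (P x) ** adj A) + adj (M x) ** adj (P x))
          + ((P x ** K) ** 0 + ((P x ** 0 + ((- \<i>) \<cdot>\<^sub>m (A ** P x ** J) + P x ** M x) ** K) ** J)) ** adj (P x))
          + 0 \<cdot>\<^sub>m (P x ** K ** J ** adj (P x)))) (at x)"
      by (intro has_vector_derivative_diff has_vector_derivative_matrix_mult
          has_vector_derivative_mat_scale has_vector_derivative_const P_deriv adj_P_deriv S_deriv)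
  next
    show "(A ** (P x ** K ** adj (P x)) + 0 ** S x) - (S x ** 0 + (P x ** K ** adj (P x)) ** adj A)
        - (\<i> \<cdot>\<^sub>m (P x ** K ** J ** (\<i> \<cdot>\<^sub>m (J ** adj (P x) ** adj A) + adj (M x) ** adj (P x))
          + ((P x ** K) ** 0 + ((P x ** 0 + ((- \<i>) \<cdot>\<^sub>m (A ** P x ** J) + P x ** M x) ** K) ** J)) ** adj (P x))
          + 0 \<cdot>\<^sub>m (P x ** K ** J ** adj (P x))) = 0"
      by (simp add: matrix_expand JK_left JJ_left M_left) (simp add: matrix_entries algebra_simps)
  qed
  then have "?D x = ?D 0" by (rule has_vector_derivative_zero_imp_eq)
  then show ?thesis by (simp add: S0_identity)
qed

text \<open>After \<open>R ** A\<close> is replaced by means of \<open>AR\<close>, the terms with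
  \<open>adj A\<close> in the two partial derivatives cancel. Everything left has the common right
  factor \<open>adj (P x) ** R ** E\<close>, and the assumption \<open>W\<close> says that its left
  factor vanishes.\<close>

lemma dressed_system:
  assumes inv: "invertible (S x)"
    and X: "X = adj (P x) ** matrix_inv (S x) ** P x"
    and W: "adj (M x) - X ** K + J ** X ** K ** J + \<i> \<cdot>\<^sub>m (J ** W) = 0"
    and \<psi>: "\<And>x \<xi>. \<psi> x \<xi> = adj (P x) ** matrix_inv (S x) ** mat_exp (- (\<xi> *\<^sub>R A))"
  obtains \<psi>\<^sub>x \<psi>\<^sub>\<xi> where
    "((\<lambda>t. \<psi> t \<xi>) has_vector_derivative \<psi>\<^sub>x) (at x)"
    "((\<lambda>t. \<psi> x t) has_vector_derivative \<psi>\<^sub>\<xi>) (at \<xi>)"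
    "\<psi>\<^sub>x + \<i> \<cdot>\<^sub>m (J ** (\<psi>\<^sub>\<xi> + W ** \<psi> x \<xi>)) = 0"
proof -
  define R where "R = matrix_inv (S x)"
  define E where "E = mat_exp (- (\<xi> *\<^sub>R A))"
  note RS = invertible_matrix_inv[OF inv, folded R_def]
  have RS_left: "R ** (S x ** Y) = Y" for Y :: "complex ^ 'k ^ 'n"
    by (simp add: matrix_mul_assoc RS)
  have exp_eq: "mat_exp (- (t *\<^sub>R A)) = mat_exp ((- 1 * complex_of_real t) \<cdot>\<^sub>m A)" for t
    using of_real_mat_scale[of "- t" A] by simp
  \<comment> \<open>Multiplying the identity for \<open>S x\<close> by its inverse on both sides
    turns \<open>A ** S x - S x ** adj A\<close> into \<open>R ** A - adj A ** R\<close>.\<close>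
  have AR: "R ** A = adj A ** R + \<i> \<cdot>\<^sub>m (R ** P x ** K ** J ** adj (P x) ** R)"
    using arg_cong[OF S_identity[of x], of "\<lambda>Y. R ** Y ** R"]
    by (simp add: matrix_expand RS RS_left algebra_simps)
  have AR_left: "R ** (A ** Y) = adj A ** (R ** Y) + \<i> \<cdot>\<^sub>m (R ** (P x ** (K ** (J ** (adj (P x) ** (R ** Y))))))"
    for Y :: "complex ^ 'k ^ 'n"
    using arg_cong[OF AR, of "\<lambda>Z. Z ** Y"] by (simp add: matrix_expand)
  let ?\<psi>x = "(adj (P x) ** (- (R ** (P x ** K ** adj (P x)) ** R))
      + (\<i> \<cdot>\<^sub>m (J ** adj (P x) ** adj A) + adj (M x) ** adj (P x)) ** R) ** E"
  let ?\<psi>\<xi> = "adj (P x) ** R ** ((- 1) \<cdot>\<^sub>m (A ** E))"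
  show thesis
  proof
    have "((\<lambda>t. adj (P t) ** matrix_inv (S t) ** E) has_vector_derivative
        (adj (P x) ** matrix_inv (S x)) ** 0 + ?\<psi>x) (at x)"
      unfolding R_def
      by (intro has_vector_derivative_matrix_mult has_vector_derivative_const adj_P_deriv
          has_vector_derivative_matrix_inv S_deriv inv)
    then show "((\<lambda>t. \<psi> t \<xi>) has_vector_derivative ?\<psi>x) (at x)"
      by (simp add: \<psi> E_def)
    have "((\<lambda>t. adj (P x) ** matrix_inv (S x) ** mat_exp ((- 1 * complex_of_real t) \<cdot>\<^sub>m A)) has_vector_derivative
        ?\<psi>\<xi> + 0 ** mat_exp ((- 1 * complex_of_real \<xi>) \<cdot>\<^sub>m A)) (at \<xi>)"
      unfolding R_def E_def exp_eq
      by (intro has_vector_derivative_matrix_mult has_vector_derivative_const mat_exp_has_vector_derivative)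
    then show "((\<lambda>t. \<psi> x t) has_vector_derivative ?\<psi>\<xi>) (at \<xi>)"
      by (simp add: \<psi> exp_eq)
    have "?\<psi>x + \<i> \<cdot>\<^sub>m (J ** (?\<psi>\<xi> + W ** (adj (P x) ** R ** E)))
      = (adj (M x) - X ** K + J ** X ** K ** J + \<i> \<cdot>\<^sub>m (J ** W)) ** (adj (P x) ** R ** E)"
      unfolding X R_def[symmetric]
      by (simp add: matrix_expand AR_left) (simp add: matrix_entries algebra_simps)
    also have "\<dots> = 0" unfolding W by simp
    finally show "?\<psi>x + \<i> \<cdot>\<^sub>m (J ** (?\<psi>\<xi> + W ** \<psi> x \<xi>)) = 0"
      by (simp add: \<psi> R_def E_def)
  qed
qed

end

section \<open>Block matrices\<close>

lemma sum_UNIV_Plus: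
  fixes f :: "'a::finite + 'b::finite \<Rightarrow> 'c::comm_monoid_add"
  shows "sum f UNIV = (\<Sum>i\<in>UNIV. f (Inl i)) + (\<Sum>i\<in>UNIV. f (Inr i))"
  by (simp add: UNIV_Plus_UNIV[symmetric] sum.Plus del: UNIV_Plus_UNIV)

lemma row_block_nth [simp]:
  "row_block M N $ i $ Inl k = M $ i $ k" "row_block M N $ i $ Inr l = N $ i $ l"
  by (simp_all add: row_block_def)

lemma four_block_nth [simp]:
  "four_block a b c d $ Inl i = row_block a b $ i" "four_block a b c d $ Inr j = row_block c d $ j"
  by (simp_all add: four_block_def)

lemma all_sum: "(\<forall>i. Q i) \<longleftrightarrow> (\<forall>i. Q (Inl i)) \<and> (\<forall>i. Q (Inr i))"
  by (metis sum.exhaust)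

lemma row_block_mult_four_block:
  "row_block L1 L2 ** four_block a b c d = row_block (L1 ** a + L2 ** c) (L1 ** b + L2 ** d)"
  by (simp add: vec_eq_iff all_sum matrix_matrix_mult_def sum_UNIV_Plus)

lemma mult_row_block: "N ** row_block a b = row_block (N ** a) (N ** b)"
  by (simp add: vec_eq_iff all_sum matrix_matrix_mult_def)

lemma adj_row_block_mult_row_block:
  "adj (row_block a b) ** row_block c d =
    four_block (adj a ** c) (adj a ** d) (adj b ** c) (adj b ** d)"
  by (simp add: vec_eq_iff all_sum matrix_matrix_mult_def adj_def)

lemma four_block_mult:
  "four_block a b c d ** four_block a' b' c' d' =
    four_block (a ** a' + b ** c') (a ** b' + b ** d') (c ** a' + d ** c') (c ** b' + d ** d')"
  by (simp add: vec_eq_iff all_sum matrix_matrix_mult_def sum_UNIV_Plus)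

lemma four_block_linear:
  "four_block a b c d + four_block a' b' c' d' = four_block (a + a') (b + b') (c + c') (d + d')"
  "four_block a b c d - four_block a' b' c' d' = four_block (a - a') (b - b') (c - c') (d - d')"
  "- four_block a b c d = four_block (- a) (- b) (- c) (- d)"
  "z \<cdot>\<^sub>m four_block a b c d = four_block (z \<cdot>\<^sub>m a) (z \<cdot>\<^sub>m b) (z \<cdot>\<^sub>m c) (z \<cdot>\<^sub>m d)"
  by (simp_all add: vec_eq_iff all_sum mat_scale_nth)

lemma row_block_linear:
  "row_block a b + row_block a' b' = row_block (a + a') (b + b')"
  "z \<cdot>\<^sub>m row_block a b = row_block (z \<cdot>\<^sub>m a) (z \<cdot>\<^sub>m b)"
  by (simp_all add: vec_eq_iff all_sum mat_scale_nth)

lemma adj_four_block: "adj (four_block a b c d) = four_block (adj a) (adj c) (adj b) (adj d)"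
  by (simp add: vec_eq_iff all_sum adj_def)

lemma four_block_mat_1: "four_block (mat 1) 0 0 (mat 1) = mat 1"
  by (simp add: vec_eq_iff all_sum mat_def)

lemmas block_simps = row_block_mult_four_block mult_row_block adj_row_block_mult_row_block
  four_block_mult four_block_linear row_block_linear adj_four_block

lemma sig_j_mult_sig_j: "sig_j ** sig_j = mat 1"
  by (simp add: sig_j_def block_simps matrix_mult_linear four_block_mat_1)

lemma adj_sig_j: "adj sig_j = sig_j"
  by (simp add: sig_j_def block_simps adj_mat adj_uminus)

lemma row_block_has_vector_derivative:
  assumes "(f has_vector_derivative f') (at x)" and "(g has_vector_derivative g') (at x)"
  shows "((\<lambda>t. row_block (f t) (g t)) has_vector_derivative row_block f' g') (at x)"
proof (intro has_vector_derivative_vecI)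
  fix i k
  show "((\<lambda>t. row_block (f t) (g t) $ i $ k) has_vector_derivative row_block f' g' $ i $ k) (at x)"
    using assms by (cases k) (auto intro: has_vector_derivative_vec_nth)
qed

section \<open>The initial solution\<close>

text \<open>Used with \<open>w = - \<i> c\<close> for \<open>\<Lambda>1\<close> and with
  \<open>w = \<i> c\<close> for \<open>\<Lambda>2\<close>.\<close>

lemma plane_wave_has_vector_derivative:
  fixes f g :: "complex ^ 'p ^ 'n"
  shows "((\<lambda>x. exp (w * complex_of_real x) \<cdot>\<^sub>m
      (mat_exp ((\<i> * of_real x) \<cdot>\<^sub>m Q) ** f + mat_exp ((- \<i> * of_real x) \<cdot>\<^sub>m Q) ** g))
    has_vector_derivative
      w \<cdot>\<^sub>m (exp (w * of_real x) \<cdot>\<^sub>m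
        (mat_exp ((\<i> * of_real x) \<cdot>\<^sub>m Q) ** f + mat_exp ((- \<i> * of_real x) \<cdot>\<^sub>m Q) ** g))
      + (\<i> * exp (w * of_real x)) \<cdot>\<^sub>m
        (Q ** (mat_exp ((\<i> * of_real x) \<cdot>\<^sub>m Q) ** f - mat_exp ((- \<i> * of_real x) \<cdot>\<^sub>m Q) ** g))) (at x)"
    (is "(?F has_vector_derivative ?F') (at x)")
proof -
  have "((\<lambda>x. w * complex_of_real x) has_vector_derivative w) (at x)"
    by (auto intro!: derivative_eq_intros)
  from field_vector_diff_chain_at[OF this DERIV_exp]
  have e: "((\<lambda>x. exp (w * complex_of_real x)) has_vector_derivative w * exp (w * of_real x)) (at x)"
    by (simp add: o_def)
  have "(?F has_vector_derivative
      exp (w * of_real x) \<cdot>\<^sub>m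
        ((mat_exp ((\<i> * of_real x) \<cdot>\<^sub>m Q) ** 0 + (\<i> \<cdot>\<^sub>m (Q ** mat_exp ((\<i> * of_real x) \<cdot>\<^sub>m Q))) ** f)
        + (mat_exp ((- \<i> * of_real x) \<cdot>\<^sub>m Q) ** 0 + (- \<i> \<cdot>\<^sub>m (Q ** mat_exp ((- \<i> * of_real x) \<cdot>\<^sub>m Q))) ** g))
      + (w * exp (w * of_real x)) \<cdot>\<^sub>m
        (mat_exp ((\<i> * of_real x) \<cdot>\<^sub>m Q) ** f + mat_exp ((- \<i> * of_real x) \<cdot>\<^sub>m Q) ** g)) (at x)"
    by (intro has_vector_derivative_mat_scale has_vector_derivative_add has_vector_derivative_matrix_mult
        has_vector_derivative_const mat_exp_has_vector_derivative e)
  then show ?thesis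
    by (rule has_vector_derivative_eq_rhs)
      (simp add: matrix_expand, simp add: matrix_entries algebra_simps)
qed

text \<open>The two columns satisfy a coupled system. The equation for \<open>\<Lambda>1\<close>
  expresses the choice of \<open>f3\<close> and \<open>f4\<close>; the one for
  \<open>\<Lambda>2\<close> follows from it and the value of \<open>Q ** Q\<close>. Only the product
  \<open>\<kappa> * \<mu>\<close> enters the latter, so both signs of the squared modulus are
  covered.\<close>

lemma initial_solution:
  fixes A Q :: "complex ^ 'n ^ 'n" and f1 f2 f3 f4 :: "complex ^ 'p ^ 'n"
    and \<Lambda>1 \<Lambda>2 :: "real \<Rightarrow> complex ^ 'p ^ 'n"
  assumes \<kappa>: "\<kappa> \<noteq> 0"
    and AQ: "A ** Q = Q ** A"
    and QQ: "Q ** Q = (A - mat (of_real c)) ** (A - mat (of_real c)) - mat (\<kappa> * \<mu>)"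
    and f3: "f3 = (1 / \<kappa>) \<cdot>\<^sub>m ((Q + A - mat (of_real c)) ** f1)"
    and f4: "f4 = - (1 / \<kappa>) \<cdot>\<^sub>m ((Q - A + mat (of_real c)) ** f2)"
    and \<Lambda>1: "\<And>x. \<Lambda>1 x = exp (- \<i> * of_real c * of_real x) \<cdot>\<^sub>m
       (mat_exp ((\<i> * of_real x) \<cdot>\<^sub>m Q) ** f1 + mat_exp ((- \<i> * of_real x) \<cdot>\<^sub>m Q) ** f2)"
    and \<Lambda>2: "\<And>x. \<Lambda>2 x = exp (\<i> * of_real c * of_real x) \<cdot>\<^sub>m
       (mat_exp ((\<i> * of_real x) \<cdot>\<^sub>m Q) ** f3 + mat_exp ((- \<i> * of_real x) \<cdot>\<^sub>m Q) ** f4)"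
  shows "((\<lambda>x. row_block (\<Lambda>1 x) (\<Lambda>2 x)) has_vector_derivative
      (- \<i>) \<cdot>\<^sub>m (A ** row_block (\<Lambda>1 x) (\<Lambda>2 x) ** sig_j) + row_block (\<Lambda>1 x) (\<Lambda>2 x) **
        four_block 0 (mat (- \<i> * \<mu> * exp (2 * \<i> * of_real c * of_real x)))
          (mat (\<i> * \<kappa> * exp (- (2 * \<i> * of_real c * of_real x)))) 0) (at x)"
proof -
  \<comment> \<open>The shift by \<open>c\<close> is compensated by the derivatives of the phases
    \<open>e\<close> and \<open>e'\<close>, leaving relations between \<open>B\<close> and
    \<open>Q\<close>.\<close>
  define B where "B = A - mat (of_real c)"
  define Ep where "Ep = mat_exp ((\<i> * of_real x) \<cdot>\<^sub>m Q)"
  define Em where "Em = mat_exp ((- \<i> * of_real x) \<cdot>\<^sub>m Q)"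
  define e where "e = exp (\<i> * of_real c * of_real x)"
  define e' where "e' = exp (- (\<i> * of_real c * of_real x))"
  define u where "u = Ep ** f1"
  define w where "w = Em ** f2"
  have ee: "e * e' = 1" by (simp add: e_def e'_def exp_minus)
  have e2: "exp (2 * \<i> * of_real c * of_real x) = e * e"
    "exp (- (2 * \<i> * of_real c * of_real x)) = e' * e'"
    unfolding e_def e'_def exp_add[symmetric] by (simp_all add: algebra_simps)
  have A: "A = B + mat (of_real c)" by (simp add: B_def)
  have BQ: "B ** Q = Q ** B"
    unfolding B_def by (simp add: matrix_expand AQ)
  have comm: "B ** Ep = Ep ** B" "B ** Em = Em ** B" "Q ** Ep = Ep ** Q" "Q ** Em = Em ** Q"
    unfolding Ep_def Em_def by (intro mat_exp_commute; simp add: matrix_expand BQ)+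
  have QQ_left: "Q ** (Q ** X) = B ** (B ** X) - (\<kappa> * \<mu>) \<cdot>\<^sub>m X" for X :: "complex ^ 'p ^ 'n"
    using arg_cong[OF QQ, of "\<lambda>Y. Y ** X"] by (simp add: B_def[symmetric] matrix_expand)
  have QB_left: "Q ** (B ** X) = B ** (Q ** X)" for X :: "complex ^ 'p ^ 'n"
    by (simp add: matrix_mul_assoc BQ)
  have comm_left: "Ep ** (B ** X) = B ** (Ep ** X)" "Em ** (B ** X) = B ** (Em ** X)"
    "Ep ** (Q ** X) = Q ** (Ep ** X)" "Em ** (Q ** X) = Q ** (Em ** X)" for X :: "complex ^ 'p ^ 'n"
    by (simp_all add: matrix_mul_assoc comm)
  have Ef3: "Ep ** f3 = (1 / \<kappa>) \<cdot>\<^sub>m (Q ** u + B ** u)"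
    unfolding f3 u_def by (simp add: A matrix_expand comm_left)
  have Ef4: "Em ** f4 = (1 / \<kappa>) \<cdot>\<^sub>m (B ** w - Q ** w)"
    unfolding f4 w_def by (simp add: A matrix_expand comm_left) (simp add: matrix_entries algebra_simps)
  have L1: "\<Lambda>1 x = e' \<cdot>\<^sub>m (u + w)"
    by (simp add: \<Lambda>1 Ep_def Em_def e'_def u_def w_def)
  have L2: "\<Lambda>2 x = (e / \<kappa>) \<cdot>\<^sub>m (Q ** u + B ** u + B ** w - Q ** w)"
    unfolding \<Lambda>2 Ep_def[symmetric] Em_def[symmetric] e_def[symmetric] Ef3 Ef4
    by (simp add: matrix_entries algebra_simps add_divide_distrib diff_divide_distrib)
  have "(\<Lambda>1 has_vector_derivative (- \<i> * of_real c) \<cdot>\<^sub>m \<Lambda>1 x + (\<i> * e') \<cdot>\<^sub>m (Q ** (u - w))) (at x)"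
    using plane_wave_has_vector_derivative[of "- \<i> * of_real c" Q f1 f2 x]
    unfolding \<Lambda>1[symmetric]
    unfolding Ep_def[symmetric] Em_def[symmetric] u_def[symmetric] w_def[symmetric]
    by (simp add: e'_def)
  moreover have "(- \<i> * of_real c) \<cdot>\<^sub>m \<Lambda>1 x + (\<i> * e') \<cdot>\<^sub>m (Q ** (u - w))
      = (- \<i>) \<cdot>\<^sub>m (A ** \<Lambda>1 x) + (\<i> * \<kappa> * (e' * e')) \<cdot>\<^sub>m \<Lambda>2 x"
  proof -
    have "\<i> * \<kappa> * (e' * e') * (e / \<kappa>) = \<i> * e' * (e * e')" using \<kappa> by (simp add: field_simps)
    then have "(\<i> * \<kappa> * (e' * e')) \<cdot>\<^sub>m \<Lambda>2 x = (\<i> * e') \<cdot>\<^sub>m (Q ** u + B ** u + B ** w - Q ** w)"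
      by (simp only: L2 mat_scale_scale ee mult_1_right)
    then show ?thesis
      by (simp add: L1 A matrix_expand) (simp add: matrix_entries algebra_simps)
  qed
  ultimately have d1: "(\<Lambda>1 has_vector_derivative
      (- \<i>) \<cdot>\<^sub>m (A ** \<Lambda>1 x) + (\<i> * \<kappa> * (e' * e')) \<cdot>\<^sub>m \<Lambda>2 x) (at x)"
    by simp
  have "(\<Lambda>2 has_vector_derivative (\<i> * of_real c) \<cdot>\<^sub>m \<Lambda>2 x + (\<i> * e) \<cdot>\<^sub>m (Q ** (Ep ** f3 - Em ** f4))) (at x)"
    using plane_wave_has_vector_derivative[of "\<i> * of_real c" Q f3 f4 x]
    unfolding \<Lambda>2[symmetric]
    unfolding Ep_def[symmetric] Em_def[symmetric]
    by (simp add: e_def)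
  moreover have "(\<i> * of_real c) \<cdot>\<^sub>m \<Lambda>2 x + (\<i> * e) \<cdot>\<^sub>m (Q ** (Ep ** f3 - Em ** f4))
      = \<i> \<cdot>\<^sub>m (A ** \<Lambda>2 x) + (- \<i> * \<mu> * (e * e)) \<cdot>\<^sub>m \<Lambda>1 x"
  proof -
    have "- \<i> * \<mu> * (e * e) * e' = - \<i> * \<mu> * e * (e * e')" by (simp add: mult_ac)
    then have eq: "(- \<i> * \<mu> * (e * e)) \<cdot>\<^sub>m \<Lambda>1 x = (- \<i> * \<mu> * e) \<cdot>\<^sub>m (u + w)"
      by (simp only: L1 mat_scale_scale ee mult_1_right)
    \<comment> \<open>Here \<open>Q\<close> acts a second time on \<open>u\<close> and
      \<open>w\<close>; \<open>QQ_left\<close> replaces its square, and the term with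
      \<open>\<kappa> * \<mu>\<close> becomes the coupling to \<open>\<Lambda>1\<close>.\<close>
    show ?thesis unfolding eq using \<kappa>
      by (simp add: L2 A Ef3 Ef4 matrix_expand QQ_left QB_left) (simp add: matrix_entries field_simps)
  qed
  ultimately have d2: "(\<Lambda>2 has_vector_derivative
      \<i> \<cdot>\<^sub>m (A ** \<Lambda>2 x) + (- \<i> * \<mu> * (e * e)) \<cdot>\<^sub>m \<Lambda>1 x) (at x)"
    by simp
  show ?thesis
    by (rule has_vector_derivative_eq_rhs[OF row_block_has_vector_derivative[OF d1 d2]])
      (simp add: sig_j_def e2 block_simps matrix_expand,
       simp add: matrix_entries all_sum algebra_simps)
qed

text \<open>The scalar \<open>z\<close> carries all sign changes: the factor
  \<open>z\<^sup>2\<close> is 1 or -1, and \<open>- 2 * \<i> * z\<close> is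
  \<open>- 2 * \<i>\<close> or 2.\<close>

lemma dirac_system_dressed:
  fixes A Q :: "complex ^ 'n ^ 'n" and f1 f2 f3 f4 :: "complex ^ 'p ^ 'n"
    and \<Lambda>1 \<Lambda>2 :: "real \<Rightarrow> complex ^ 'p ^ 'n" and K :: "complex ^ ('p + 'p) ^ ('p + 'p)"
    and z :: complex
  assumes a: "a \<noteq> 0"
    and z: "z = 1 \<and> K = mat 1 \<or> z = \<i> \<and> K = sig_j"
    and AQ: "A ** Q = Q ** A"
    and QQ: "Q ** Q = (A - mat (of_real c)) ** (A - mat (of_real c)) - mat (z\<^sup>2 * of_real ((cmod a)\<^sup>2))"
    and f3: "f3 = (z / cnj a) \<cdot>\<^sub>m ((Q + A - mat (of_real c)) ** f1)"
    and f4: "f4 = - (z / cnj a) \<cdot>\<^sub>m ((Q - A + mat (of_real c)) ** f2)"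
    and \<Lambda>1: "\<And>x. \<Lambda>1 x = exp (- \<i> * of_real c * of_real x) \<cdot>\<^sub>m
       (mat_exp ((\<i> * of_real x) \<cdot>\<^sub>m Q) ** f1 + mat_exp ((- \<i> * of_real x) \<cdot>\<^sub>m Q) ** f2)"
    and \<Lambda>2: "\<And>x. \<Lambda>2 x = exp (\<i> * of_real c * of_real x) \<cdot>\<^sub>m
       (mat_exp ((\<i> * of_real x) \<cdot>\<^sub>m Q) ** f3 + mat_exp ((- \<i> * of_real x) \<cdot>\<^sub>m Q) ** f4)"
    and P: "\<And>x. P x = row_block (\<Lambda>1 x) (\<Lambda>2 x)"
    and S0_adj: "S 0 = adj (S 0)"
    and S0_identity: "A ** S 0 - S 0 ** adj A = \<i> \<cdot>\<^sub>m (P 0 ** K ** sig_j ** adj (P 0))"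
    and S_integral: "\<And>x. S x = S 0 + (LBINT r=0..ereal x. P r ** K ** adj (P r))"
    and \<psi>: "\<And>x \<xi>. \<psi> x \<xi> = adj (P x) ** matrix_inv (S x) ** mat_exp (- (\<xi> *\<^sub>R A))"
    and vt: "\<And>x. vt x = mat (a * exp (2 * \<i> * of_real c * of_real x))
      - (2 * \<i> * z) \<cdot>\<^sub>m (adj (\<Lambda>1 x) ** matrix_inv (S x) ** \<Lambda>2 x)"
    and inv: "invertible (S x)"
  shows "dirac_system_at (\<lambda>x. z \<cdot>\<^sub>m off_diag (vt x)) \<psi> x \<xi>"
proof -
  define v where "v = (\<lambda>x. a * exp (2 * \<i> * complex_of_real c * of_real x))"
  define M where "M = (\<lambda>x. four_block 0 (mat (- \<i> * cnj z * v x)) (mat (\<i> * cnj z * cnj (v x))) 0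
    :: complex ^ ('p + 'p) ^ ('p + 'p))"
  \<comment> \<open>Chosen so that \<open>1 / \<kappa>\<close> is the factor in \<open>f3\<close>
    and \<open>f4\<close>. The partner is \<open>\<mu> = cnj z * a\<close>; their product is as
    required because \<open>1 / z = cnj z\<close> and \<open>cnj z * cnj z = z\<^sup>2\<close> in
    both cases.\<close>
  define \<kappa> where "\<kappa> = cnj a / z"
  have z0: "z \<noteq> 0" and inv_z: "1 / z = cnj z" and z2: "cnj z * cnj z = z\<^sup>2"
    using z by (auto simp: divide_simps)
  have \<kappa>: "\<kappa> \<noteq> 0" "1 / \<kappa> = z / cnj a" "\<kappa> = cnj z * cnj a"
    using a z0 inv_z by (auto simp: \<kappa>_def field_simps)
  have "\<kappa> * (cnj z * a) = z\<^sup>2 * of_real ((cmod a)\<^sup>2)"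
    unfolding \<kappa>(3) complex_norm_square z2[symmetric] by (simp add: mult_ac)
  note P_deriv = initial_solution[OF \<kappa>(1) AQ QQ[folded this] f3[folded \<kappa>(2)] f4[folded \<kappa>(2)] \<Lambda>1 \<Lambda>2]
  have cnj_v: "cnj (v x) = cnj a * exp (- (2 * \<i> * of_real c * of_real x))" for x
    by (simp add: v_def exp_cnj)
  interpret dressing A sig_j K P M S
  proof
    show "sig_j ** sig_j = (mat 1 :: complex ^ ('p + 'p) ^ ('p + 'p))"
      "adj sig_j = (sig_j :: complex ^ ('p + 'p) ^ ('p + 'p))"
      by (fact sig_j_mult_sig_j adj_sig_j)+
    show "adj K = K" "sig_j ** K = K ** sig_j"
      using z by (auto simp: adj_mat adj_sig_j)
    show "(P has_vector_derivative (- \<i>) \<cdot>\<^sub>m (A ** P x ** sig_j) + P x ** M x) (at x)" for x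
      using P_deriv[of x] unfolding P[symmetric] M_def cnj_v \<kappa>(3)
      unfolding v_def by (simp add: mult_ac)
    show "M x ** K ** sig_j = - (K ** sig_j ** adj (M x))" for x
      using z unfolding M_def sig_j_def
      by (elim disjE conjE)
        (simp_all add: block_simps matrix_expand adj_mat four_block_mat_1[symmetric],
         simp_all add: matrix_entries all_sum mat_def)
    show "adj (S 0) = S 0" using S0_adj by simp
  qed (fact S_integral S0_identity)+
  define R where "R = matrix_inv (S x)"
  \<comment> \<open>Self-adjointness makes the lower left block of \<open>?X\<close> the adjoint of
    the upper right one, matching the shape of \<open>off_diag\<close>.\<close>
  have R: "adj R = R" unfolding R_def by (rule adj_matrix_inv[OF inv S_adj])
  have vtx: "vt x = mat (v x) - (2 * \<i> * z) \<cdot>\<^sub>m (adj (\<Lambda>1 x) ** (R ** \<Lambda>2 x))"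
    by (simp add: vt v_def R_def matrix_mul_assoc)
  have adj_vtx: "adj (vt x) = mat (cnj (v x)) - cnj (2 * \<i> * z) \<cdot>\<^sub>m (adj (\<Lambda>2 x) ** (R ** \<Lambda>1 x))"
    by (simp add: vtx adj_diff adj_scale adj_mult adj_mat R matrix_mul_assoc)
  let ?X = "four_block (adj (\<Lambda>1 x) ** (R ** \<Lambda>1 x)) (adj (\<Lambda>1 x) ** (R ** \<Lambda>2 x))
    (adj (\<Lambda>2 x) ** (R ** \<Lambda>1 x)) (adj (\<Lambda>2 x) ** (R ** \<Lambda>2 x))"
  have X: "?X = adj (P x) ** matrix_inv (S x) ** P x"
    by (simp only: P R_def[symmetric] matrix_mul_assoc[symmetric] mult_row_block[of R]
        adj_row_block_mult_row_block)
  \<comment> \<open>For any block matrix \<open>Y\<close>, \<open>- Y + sig_j ** Y ** sig_j\<close>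
    is -2 times its off-diagonal part. With \<open>Y = ?X ** K\<close> exactly the corrections that
    distinguish \<open>vt x\<close> from \<open>v x\<close> remain.\<close>
  have W: "adj (M x) - ?X ** K + sig_j ** ?X ** K ** sig_j
      + \<i> \<cdot>\<^sub>m (sig_j ** (z \<cdot>\<^sub>m off_diag (vt x))) = 0"
    using z unfolding M_def sig_j_def off_diag_def adj_vtx
    unfolding vtx
    by (elim disjE conjE)
      (simp_all add: block_simps matrix_expand adj_mat,
       simp_all add: matrix_entries all_sum mat_def algebra_simps)
  show ?thesis
    unfolding dirac_system_at_def
    using dressed_system[OF inv X W \<psi>] by metis
qed

section \<open>Existence of \<open>Q\<close> and specialisation of the dressed system to (i) and
  (ii)\<close>

theorem theorem4p1:
  fixes a :: complex and c :: real and A :: "complex ^ 'n ^ 'n"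
    and v :: "real \<Rightarrow> complex ^ 'p ^ 'p"
  assumes a: "a \<noteq> 0"
    and v: "\<And>x. v x = mat (a * exp (2 * \<i> * of_real c * of_real x))"
  shows
    "(det ((A - mat (of_real c)) ** (A - mat (of_real c)) - mat (of_real ((cmod a)\<^sup>2))) \<noteq> 0 \<longrightarrow>
        (\<exists>Q. A ** Q = Q ** A \<and> Q ** Q = (A - mat (of_real c)) ** (A - mat (of_real c)) - mat (of_real ((cmod a)\<^sup>2))) \<and>
        (\<forall>(Q :: complex ^ 'n ^ 'n) (f1 :: complex ^ 'p ^ 'n) f2 f3 f4 \<Lambda>1 \<Lambda>2 P S \<psi> vt.
          A ** Q = Q ** A \<longrightarrow>
          Q ** Q = (A - mat (of_real c)) ** (A - mat (of_real c)) - mat (of_real ((cmod a)\<^sup>2)) \<longrightarrow>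
          f3 = (1 / cnj a) \<cdot>\<^sub>m ((Q + A - mat (of_real c)) ** f1) \<longrightarrow>
          f4 = - (1 / cnj a) \<cdot>\<^sub>m ((Q - A + mat (of_real c)) ** f2) \<longrightarrow>
          (\<forall>x. \<Lambda>1 x = exp (- \<i> * of_real c * of_real x) \<cdot>\<^sub>m
             (mat_exp ((\<i> * of_real x) \<cdot>\<^sub>m Q) ** f1 + mat_exp ((- \<i> * of_real x) \<cdot>\<^sub>m Q) ** f2)) \<longrightarrow>
          (\<forall>x. \<Lambda>2 x = exp (\<i> * of_real c * of_real x) \<cdot>\<^sub>m
             (mat_exp ((\<i> * of_real x) \<cdot>\<^sub>m Q) ** f3 + mat_exp ((- \<i> * of_real x) \<cdot>\<^sub>m Q) ** f4)) \<longrightarrow>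
          (\<forall>x. P x = row_block (\<Lambda>1 x) (\<Lambda>2 x)) \<longrightarrow>
          S 0 = adj (S 0) \<longrightarrow>
          A ** S 0 - S 0 ** adj A = \<i> \<cdot>\<^sub>m (P 0 ** sig_j ** adj (P 0)) \<longrightarrow>
          (\<forall>x. S x = S 0 + (LBINT r=0..ereal x. P r ** adj (P r))) \<longrightarrow>
          (\<forall>x \<xi>. \<psi> x \<xi> = adj (P x) ** matrix_inv (S x) ** mat_exp (- (\<xi> *\<^sub>R A))) \<longrightarrow>
          (\<forall>x. vt x = v x - (2 * \<i>) \<cdot>\<^sub>m (adj (\<Lambda>1 x) ** matrix_inv (S x) ** \<Lambda>2 x)) \<longrightarrow>
          (\<forall>x \<xi>. invertible (S x) \<longrightarrow>
             dirac_system_at (\<lambda>x. off_diag (vt x)) \<psi> x \<xi>)))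
     \<and>
     (det ((A - mat (of_real c)) ** (A - mat (of_real c)) + mat (of_real ((cmod a)\<^sup>2))) \<noteq> 0 \<longrightarrow>
        (\<exists>Q. A ** Q = Q ** A \<and> Q ** Q = (A - mat (of_real c)) ** (A - mat (of_real c)) + mat (of_real ((cmod a)\<^sup>2))) \<and>
        (\<forall>(Q :: complex ^ 'n ^ 'n) (f1 :: complex ^ 'p ^ 'n) f2 f3 f4 \<Lambda>1 \<Lambda>2 P S \<psi> vt.
          A ** Q = Q ** A \<longrightarrow>
          Q ** Q = (A - mat (of_real c)) ** (A - mat (of_real c)) + mat (of_real ((cmod a)\<^sup>2)) \<longrightarrow>
          f3 = (\<i> / cnj a) \<cdot>\<^sub>m ((Q + A - mat (of_real c)) ** f1) \<longrightarrow>
          f4 = - (\<i> / cnj a) \<cdot>\<^sub>m ((Q - A + mat (of_real c)) ** f2) \<longrightarrow>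
          (\<forall>x. \<Lambda>1 x = exp (- \<i> * of_real c * of_real x) \<cdot>\<^sub>m
             (mat_exp ((\<i> * of_real x) \<cdot>\<^sub>m Q) ** f1 + mat_exp ((- \<i> * of_real x) \<cdot>\<^sub>m Q) ** f2)) \<longrightarrow>
          (\<forall>x. \<Lambda>2 x = exp (\<i> * of_real c * of_real x) \<cdot>\<^sub>m
             (mat_exp ((\<i> * of_real x) \<cdot>\<^sub>m Q) ** f3 + mat_exp ((- \<i> * of_real x) \<cdot>\<^sub>m Q) ** f4)) \<longrightarrow>
          (\<forall>x. P x = row_block (\<Lambda>1 x) (\<Lambda>2 x)) \<longrightarrow>
          S 0 = adj (S 0) \<longrightarrow>
          A ** S 0 - S 0 ** adj A = \<i> \<cdot>\<^sub>m (P 0 ** adj (P 0)) \<longrightarrow>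
          (\<forall>x. S x = S 0 + (LBINT r=0..ereal x. P r ** sig_j ** adj (P r))) \<longrightarrow>
          (\<forall>x \<xi>. \<psi> x \<xi> = adj (P x) ** matrix_inv (S x) ** mat_exp (- (\<xi> *\<^sub>R A))) \<longrightarrow>
          (\<forall>x. vt x = v x + 2 \<cdot>\<^sub>m (adj (\<Lambda>1 x) ** matrix_inv (S x) ** \<Lambda>2 x)) \<longrightarrow>
          (\<forall>x \<xi>. invertible (S x) \<longrightarrow>
             dirac_system_at (\<lambda>x. \<i> \<cdot>\<^sub>m off_diag (vt x)) \<psi> x \<xi>)))"
proof -
  let ?B = "A - mat (of_real c)"
  have comm: "A ** (?B ** ?B + mat t) = (?B ** ?B + mat t) ** A" for t
    by (simp add: matrix_expand)
  have mat_minus: "mat (- t) = - (mat t :: complex ^ 'n ^ 'n)" for t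
    by (simp add: mat_def vec_eq_iff)
  show ?thesis
  \<comment> \<open>Cases 1 and 3 are the existence of \<open>Q\<close>, cases 2 and 4 the Dirac
    systems of (i) and (ii).\<close>
  proof (intro conjI impI allI, goal_cases)
    case 1
    then show ?case
      using comm[of "- of_real ((cmod a)\<^sup>2)"] by (intro exists_commuting_sqrt) (simp_all add: mat_minus)
  next
    case (2 Q f1 f2 f3 f4 \<Lambda>1 \<Lambda>2 P S \<psi> vt x \<xi>)
    \<comment> \<open>The weight \<open>K\<close> is the identity here and is inserted to match the
      general form.\<close>
    have S0_identity: "A ** S 0 - S 0 ** adj A = \<i> \<cdot>\<^sub>m (P 0 ** mat 1 ** sig_j ** adj (P 0))"
      and S_integral: "S y = S 0 + (LBINT r=0..ereal y. P r ** mat 1 ** adj (P r))" for y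
      unfolding matrix_mul_rid by (rule 2(10)) (rule 2(11)[rule_format])
    have "dirac_system_at (\<lambda>x. 1 \<cdot>\<^sub>m off_diag (vt x)) \<psi> x \<xi>"
      by (rule dirac_system_dressed[where z = 1, OF a _ 2(2) _ _ _ 2(6)[rule_format] 2(7)[rule_format]
            2(8)[rule_format] 2(9) S0_identity S_integral 2(12)[rule_format] _ 2(14)])
        (simp_all add: 2(3-5,13) v)
    then show ?case by simp
  next
    case 3
    then show ?case
      using comm[of "of_real ((cmod a)\<^sup>2)"] by (intro exists_commuting_sqrt) simp_all
  next
    case (4 Q f1 f2 f3 f4 \<Lambda>1 \<Lambda>2 P S \<psi> vt x \<xi>)
    \<comment> \<open>Now \<open>K\<close> is j, and the product of the two copies of j is the
      identity, so the assumed relation without j is the general one.\<close>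
    have S0_identity: "A ** S 0 - S 0 ** adj A = \<i> \<cdot>\<^sub>m (P 0 ** sig_j ** sig_j ** adj (P 0))"
      unfolding matrix_mul_assoc[symmetric, of _ sig_j sig_j] sig_j_mult_sig_j matrix_mul_rid
      by (rule 4(10))
    have scale: "2 \<cdot>\<^sub>m N = - ((2 * \<i> * \<i>) \<cdot>\<^sub>m N)" for N :: "complex ^ 'p ^ 'p"
      by (simp add: matrix_entries mult.assoc)
    show ?case
      by (rule dirac_system_dressed[where z = \<i>, OF a _ 4(2) _ _ _ 4(6)[rule_format] 4(7)[rule_format]
            4(8)[rule_format] 4(9) S0_identity 4(11)[rule_format] 4(12)[rule_format] _ 4(14)])
        (simp_all add: 4(3-5,13) v mat_minus scale)
  qed
qed

end
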